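(* Let $\vec U=\varprojlim(\vec U_p\mid p\in P)$ be a profinite universe (an inverse limit of finite universes of separations) and $\mathcal{B}$ a family of non-empty closed subsets of $\vec U$. If $\mathcal{B}$ splinters, then there is a closed nested set $N\subseteq\vec U$ containing at least one element from each member of $\mathcal{B}$.
   Context: A separation system is a poset with an order-reversing involution $\vec s\mapsto\overleftarrow{s}$; its elements are oriented separations, $s=\{\vec s,\overleftarrow s\}$ the underlying unoriented separation. A universe is a separation system which is a lattice with join $\lor$ and meet $\land$. Separations $r,s$ are nested if $\vec r\le\vec s$ for suitable orientations, and cross otherwise; a set is nested if its elements are pairwise nested. The corner separations of $r,s$ are $\vec r\lor\vec s,\vec r\lor\overleftarrow s,\overleftarrow r\lor\vec s,\overleftarrow r\lor\overleftarrow s$ (and their underlying unoriented separations). A homomorphism of universes commutes with involution, joins and meets. A directed set is a poset $P$ in which any two elements have a common upper bound. An inverse system of finite universes is a family $(\vec U_p)_{p\in P}$ of finite universes over a directed set $P$ with homomorphisms $f_{qp}\colon\vec U_q\to\vec U_p$ for $q>p$ satisfying $f_{rp}=f_{qp}\circ f_{rq}$ for $r>q>p$. Its inverse limit is the set of families $(\vec s_p)_{p\in P}$ with $\vec s_p\in\vec U_p$ and $f_{qp}(\vec s_q)=\vec s_p$ for $q>p$, a universe with involution, order, joins and meets defined coordinatewise. It carries the subspace topology of the product $\prod_p\vec U_p$ of discrete spaces; "closed" refers to this topology. A family $\mathcal{B}$ of subsets of $\vec U$ splinters if for all $B,B'\in\mathcal{B}$ and all $\vec r\in B$, $\vec s\in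 B'$: $\vec r\in B'$, or $\vec s\in B$, or $B\cup B'$ contains a corner separation of $r$ and $s$ (in some orientation). *)

theory Defs
  imports "HOL-Analysis.Function_Topology" "HOL-Algebra.Lattice"
begin

section \<open>Separation systems and universes\<close>

record 'a sep_system = "'a gorder" +
  flip :: "'a \<Rightarrow> 'a"

locale separation_system = partial_order S for S (structure) +
  assumes flip_closed: "x \<in> carrier S \<Longrightarrow> flip S x \<in> carrier S"
    and flip_flip: "x \<in> carrier S \<Longrightarrow> flip S (flip S x) = x"
    and flip_antimono:
      "\<lbrakk>x \<in> carrier S; y \<in> carrier S; x \<sqsubseteq> y\<rbrakk> \<Longrightarrow> flip S y \<sqsubseteq> flip S x"

locale universe = separation_system S + lattice S for S (structure)

definition universe_hom :: "'a sep_system \<Rightarrow> 'b sep_system \<Rightarrow> ('a \<Rightarrow> 'b) set" where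
  "universe_hom S T =
    {h \<in> carrier S \<rightarrow> carrier T.
      (\<forall>x\<in>carrier S. h (flip S x) = flip T (h x)) \<and>
      (\<forall>x\<in>carrier S. \<forall>y\<in>carrier S. h (x \<squnion>\<^bsub>S\<^esub> y) = h x \<squnion>\<^bsub>T\<^esub> h y) \<and>
      (\<forall>x\<in>carrier S. \<forall>y\<in>carrier S. h (x \<sqinter>\<^bsub>S\<^esub> y) = h x \<sqinter>\<^bsub>T\<^esub> h y)}"

text \<open>The unoriented separation underlying an oriented separation is its set of orientations.\<close>

definition orientations :: "'a sep_system \<Rightarrow> 'a \<Rightarrow> 'a set" where
  "orientations S x = {x, flip S x}"

definition nested_seps :: "'a sep_system \<Rightarrow> 'a \<Rightarrow> 'a \<Rightarrow> bool" where
  "nested_seps S r s \<longleftrightarrow>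
    (\<exists>r'\<in>orientations S r. \<exists>s'\<in>orientations S s. r' \<sqsubseteq>\<^bsub>S\<^esub> s')"

definition nested_set :: "'a sep_system \<Rightarrow> 'a set \<Rightarrow> bool" where
  "nested_set S N \<longleftrightarrow> (\<forall>r\<in>N. \<forall>s\<in>N. nested_seps S r s)"

definition corners :: "'a sep_system \<Rightarrow> 'a \<Rightarrow> 'a \<Rightarrow> 'a set" where
  "corners S r s = {r' \<squnion>\<^bsub>S\<^esub> s' | r' s'. r' \<in> orientations S r \<and> s' \<in> orientations S s}"

definition splinters :: "'a sep_system \<Rightarrow> 'a set set \<Rightarrow> bool" where
  "splinters S \<B> \<longleftrightarrow>
    (\<forall>B\<in>\<B>. \<forall>B'\<in>\<B>. \<forall>r\<in>B. \<forall>s\<in>B'.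
      r \<in> B' \<or> s \<in> B \<or> (\<exists>c\<in>corners S r s. orientations S c \<inter> (B \<union> B') \<noteq> {}))"


section \<open>Inverse systems and inverse limits\<close>

locale directed_set = partial_order P for P (structure) +
  assumes directed:
    "\<lbrakk>p \<in> carrier P; q \<in> carrier P\<rbrakk> \<Longrightarrow> \<exists>r\<in>carrier P. p \<sqsubseteq> r \<and> q \<sqsubseteq> r"

text \<open>All universes of the system share one element type but have arbitrary carriers and
  structures. The bonding map \<open>f q p\<close> is only meaningful for \<open>p\<close> strictly below \<open>q\<close>.\<close>

locale finite_universe_inverse_system = directed_set P
  for P :: "'p gorder" (structure) and U :: "'p \<Rightarrow> 'a sep_system"
    and f :: "'p \<Rightarrow> 'p \<Rightarrow> 'a \<Rightarrow> 'a" +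
  assumes universe: "p \<in> carrier P \<Longrightarrow> universe (U p)"
    and finite: "p \<in> carrier P \<Longrightarrow> finite (carrier (U p))"
    and bonding_hom:
      "\<lbrakk>p \<in> carrier P; q \<in> carrier P; p \<sqsubset> q\<rbrakk> \<Longrightarrow> f q p \<in> universe_hom (U q) (U p)"
    and bonding_comp:
      "\<lbrakk>p \<in> carrier P; q \<in> carrier P; r \<in> carrier P; p \<sqsubset> q; q \<sqsubset> r; x \<in> carrier (U r)\<rbrakk>
        \<Longrightarrow> f r p x = f q p (f r q x)"

text \<open>Joins and meets of the limit are those of its coordinatewise order; they are shown
  below to be the coordinatewise ones.\<close>

definition inverse_limit ::
  "'p gorder \<Rightarrow> ('p \<Rightarrow> 'a sep_system) \<Rightarrow> ('p \<Rightarrow> 'p \<Rightarrow> 'a \<Rightarrow> 'a) \<Rightarrow> ('p \<Rightarrow> 'a) sep_system" where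
  "inverse_limit P U f =
    \<lparr>carrier = {s \<in> (\<Pi>\<^sub>E p\<in>carrier P. carrier (U p)).
                 \<forall>p\<in>carrier P. \<forall>q\<in>carrier P. p \<sqsubset>\<^bsub>P\<^esub> q \<longrightarrow> f q p (s q) = s p},
     eq = (=),
     le = (\<lambda>s t. \<forall>p\<in>carrier P. s p \<sqsubseteq>\<^bsub>U p\<^esub> t p),
     flip = (\<lambda>s. \<lambda>p\<in>carrier P. flip (U p) (s p))\<rparr>"

definition limit_topology ::
  "'p gorder \<Rightarrow> ('p \<Rightarrow> 'a sep_system) \<Rightarrow> ('p \<Rightarrow> 'p \<Rightarrow> 'a \<Rightarrow> 'a) \<Rightarrow> ('p \<Rightarrow> 'a) topology" where
  "limit_topology P U f =
    subtopology (product_topology (\<lambda>p. discrete_topology (carrier (U p))) (carrier P))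
      (carrier (inverse_limit P U f))"

context finite_universe_inverse_system
begin

abbreviation (input) L where "L \<equiv> inverse_limit P U f"

lemma carrier_limitD:
  assumes "s \<in> carrier L"
  shows "s \<in> (\<Pi>\<^sub>E p\<in>carrier P. carrier (U p))"
    and "p \<in> carrier P \<Longrightarrow> s p \<in> carrier (U p)"
    and "\<lbrakk>p \<in> carrier P; q \<in> carrier P; p \<sqsubset> q\<rbrakk> \<Longrightarrow> f q p (s q) = s p"
  using assms by (auto simp: inverse_limit_def)

lemma le_limit: "s \<sqsubseteq>\<^bsub>L\<^esub> t \<longleftrightarrow> (\<forall>p\<in>carrier P. s p \<sqsubseteq>\<^bsub>U p\<^esub> t p)"
  by (simp add: inverse_limit_def)

lemma flip_limit: "flip L s = (\<lambda>p\<in>carrier P. flip (U p) (s p))"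
  by (simp add: inverse_limit_def)

lemma separation_system_coord: "p \<in> carrier P \<Longrightarrow> separation_system (U p)"
  using universe by (simp add: universe_def)

lemma separation_system_limit: "separation_system L"
proof
  show "(.=\<^bsub>L\<^esub>) = (=)"
    by (simp add: inverse_limit_def)
next
  fix x assume x: "x \<in> carrier L"
  show "x \<sqsubseteq>\<^bsub>L\<^esub> x"
    using carrier_limitD(2)[OF x] universe
    by (auto simp: le_limit universe_def separation_system_def partial_order_def
        intro: weak_partial_order.le_refl)
  show "flip L x \<in> carrier L"
  proof -
    have "flip (U p) (x p) \<in> carrier (U p)" if "p \<in> carrier P" for p
      using separation_system.flip_closed universe[OF that] carrier_limitD(2)[OF x that]
      by (auto simp: universe_def)
    moreover have "f q p (flip (U q) (x q)) = flip (U p) (x p)"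
      if "p \<in> carrier P" "q \<in> carrier P" "p \<sqsubset> q" for p q
      using bonding_hom[OF that] carrier_limitD(2)[OF x that(2)] carrier_limitD(3)[OF x that]
      by (auto simp: universe_hom_def)
    ultimately show ?thesis by (auto simp: inverse_limit_def)
  qed
  show "flip L (flip L x) = x"
    using carrier_limitD(1)[OF x]
    by (auto simp: flip_limit fun_eq_iff PiE_iff extensional_def
        separation_system.flip_flip[OF separation_system_coord])
next
  fix x y assume xy: "x \<in> carrier L" "y \<in> carrier L" "x \<sqsubseteq>\<^bsub>L\<^esub> y"
  show "flip L y \<sqsubseteq>\<^bsub>L\<^esub> flip L x"
    using xy carrier_limitD(2)
    by (auto simp: flip_limit le_limit
        intro: separation_system.flip_antimono[OF separation_system_coord])
next
  fix x y assume xy: "x \<in> carrier L" "y \<in> carrier L" "x \<sqsubseteq>\<^bsub>L\<^esub> y" "y \<sqsubseteq>\<^bsub>L\<^esub> x"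
  have "x p = y p" if p: "p \<in> carrier P" for p
    using partial_order.le_antisym[of "U p" "x p" "y p"] universe[OF p] xy p carrier_limitD(2)
    by (auto simp: universe_def separation_system_def le_limit)
  then show "x .=\<^bsub>L\<^esub> y"
    using PiE_ext[OF carrier_limitD(1)[OF xy(1)] carrier_limitD(1)[OF xy(2)]]
    by (simp add: inverse_limit_def)
next
  fix x y z
  assume xyz: "x \<in> carrier L" "y \<in> carrier L" "z \<in> carrier L" "x \<sqsubseteq>\<^bsub>L\<^esub> y" "y \<sqsubseteq>\<^bsub>L\<^esub> z"
  have "x p \<sqsubseteq>\<^bsub>U p\<^esub> z p" if p: "p \<in> carrier P" for p
    using weak_partial_order.le_trans[of "U p" "x p" "y p" "z p"] universe[OF p] xyz p
      carrier_limitD(2)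
    by (auto simp: universe_def separation_system_def partial_order_def le_limit)
  then show "x \<sqsubseteq>\<^bsub>L\<^esub> z"
    by (simp add: le_limit)
qed (auto simp: inverse_limit_def)

lemma join_coordinatewise_least:
  assumes s: "s \<in> carrier L" and t: "t \<in> carrier L"
  shows "least L (\<lambda>p\<in>carrier P. s p \<squnion>\<^bsub>U p\<^esub> t p) (Upper L {s, t})" (is "least L ?j _")
proof -
  have ups: "weak_upper_semilattice (U p)" if "p \<in> carrier P" for p
  proof -
    interpret universe "U p" by (rule universe[OF that])
    show ?thesis by unfold_locales
  qed
  have "f q p (s q \<squnion>\<^bsub>U q\<^esub> t q) = s p \<squnion>\<^bsub>U p\<^esub> t p"
    if "p \<in> carrier P" "q \<in> carrier P" "p \<sqsubset> q" for p q
    using bonding_hom[OF that] carrier_limitD(2,3) s t that by (auto simp: universe_hom_def)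
  then have j: "?j \<in> carrier L"
    using weak_upper_semilattice.join_closed[OF ups] carrier_limitD(2) s t
    by (auto simp: inverse_limit_def)
  have "s \<sqsubseteq>\<^bsub>L\<^esub> ?j" "t \<sqsubseteq>\<^bsub>L\<^esub> ?j"
    using weak_upper_semilattice.join_left[OF ups] weak_upper_semilattice.join_right[OF ups]
      carrier_limitD(2) s t by (auto simp: le_limit)
  moreover have "?j \<sqsubseteq>\<^bsub>L\<^esub> u" if "u \<in> carrier L" "s \<sqsubseteq>\<^bsub>L\<^esub> u" "t \<sqsubseteq>\<^bsub>L\<^esub> u" for u
    using weak_upper_semilattice.join_le[OF ups] that carrier_limitD(2) s t
    by (auto simp: le_limit)
  ultimately show ?thesis
    using j s t by (auto simp: least_def Upper_def)
qed

lemma meet_coordinatewise_greatest: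
  assumes s: "s \<in> carrier L" and t: "t \<in> carrier L"
  shows "greatest L (\<lambda>p\<in>carrier P. s p \<sqinter>\<^bsub>U p\<^esub> t p) (Lower L {s, t})" (is "greatest L ?m _")
proof -
  have lows: "weak_lower_semilattice (U p)" if "p \<in> carrier P" for p
  proof -
    interpret universe "U p" by (rule universe[OF that])
    show ?thesis by unfold_locales
  qed
  have "f q p (s q \<sqinter>\<^bsub>U q\<^esub> t q) = s p \<sqinter>\<^bsub>U p\<^esub> t p"
    if "p \<in> carrier P" "q \<in> carrier P" "p \<sqsubset> q" for p q
    using bonding_hom[OF that] carrier_limitD(2,3) s t that by (auto simp: universe_hom_def)
  then have m: "?m \<in> carrier L"
    using weak_lower_semilattice.meet_closed[OF lows] carrier_limitD(2) s t
    by (auto simp: inverse_limit_def)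
  have "?m \<sqsubseteq>\<^bsub>L\<^esub> s" "?m \<sqsubseteq>\<^bsub>L\<^esub> t"
    using weak_lower_semilattice.meet_left[OF lows] weak_lower_semilattice.meet_right[OF lows]
      carrier_limitD(2) s t by (auto simp: le_limit)
  moreover have "u \<sqsubseteq>\<^bsub>L\<^esub> ?m" if "u \<in> carrier L" "u \<sqsubseteq>\<^bsub>L\<^esub> s" "u \<sqsubseteq>\<^bsub>L\<^esub> t" for u
    using weak_lower_semilattice.meet_le[OF lows] that carrier_limitD(2) s t
    by (auto simp: le_limit)
  ultimately show ?thesis
    using m s t by (auto simp: greatest_def Lower_def)
qed

lemma universe_limit: "universe L"
proof -
  interpret separation_system L by (rule separation_system_limit)
  show ?thesis
    by unfold_locales
      (use join_coordinatewise_least meet_coordinatewise_greatest in blast)+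
qed

lemma join_limit:
  assumes "s \<in> carrier L" "t \<in> carrier L"
  shows "s \<squnion>\<^bsub>L\<^esub> t = (\<lambda>p\<in>carrier P. s p \<squnion>\<^bsub>U p\<^esub> t p)"
proof -
  interpret lim: universe L by (rule universe_limit)
  show ?thesis
    unfolding join_def[of L] sup_def[of L]
    by (rule some_equality) (use join_coordinatewise_least[OF assms] lim.least_unique in blast)+
qed

lemma meet_limit:
  assumes "s \<in> carrier L" "t \<in> carrier L"
  shows "s \<sqinter>\<^bsub>L\<^esub> t = (\<lambda>p\<in>carrier P. s p \<sqinter>\<^bsub>U p\<^esub> t p)"
proof -
  interpret lim: universe L by (rule universe_limit)
  show ?thesis
    unfolding meet_def[of L] inf_def[of L]
    by (rule some_equality)
      (use meet_coordinatewise_greatest[OF assms] lim.greatest_unique in blast)+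
qed

end

end

theory Submission
  imports Defs "HOL-Analysis.Product_Topology"
begin

text \<open>A finite splintering family has a nested transversal, by induction on its size. If some
  element \<open>a\<close> of a member is nested with an element of every other member, restrict the other
  members to the elements nested with \<open>a\<close>; by the fish lemma the restricted family still splinters.
  Otherwise take a nested transversal of all members but one, \<open>A\<^sub>n\<close>, and any \<open>a \<in> A\<^sub>n\<close>. Some other
  member \<open>A\<^sub>j\<close> has only elements crossing \<open>a\<close>, while the chosen element of \<open>A\<^sub>j\<close> crosses all of
  \<open>A\<^sub>n\<close>; this contradicts splintering for these two separations.

  In a profinite universe nestedness is a closed relation, so Tychonoff's theorem yields a nested
  transversal of the whole family, and its closure is still nested.\<close>

section \<open>Nested separations\<close>

text \<open>The locales of the definitions allow record extensions of \<open>sep_system\<close>, whereas nestedness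
  and corners are defined for plain records only.\<close>

locale plain_separation_system = separation_system S for S :: "'a sep_system" (structure)

locale plain_universe = plain_separation_system S + universe S
  for S :: "'a sep_system" (structure)

lemma splintersE:
  assumes spl: "splinters S \<B>" and "B \<in> \<B>" "B' \<in> \<B>" "r \<in> B" "s \<in> B'" "r \<notin> B'" "s \<notin> B"
  obtains c c' where "c \<in> corners S r s" "c' \<in> orientations S c" "c' \<in> B \<union> B'"
proof -
  have "\<exists>c\<in>corners S r s. orientations S c \<inter> (B \<union> B') \<noteq> {}"
    using spl[unfolded splinters_def, rule_format, OF assms(2-5)] assms(6,7) by simp
  then show thesis using that by (meson disjoint_iff)
qed

context plain_separation_system
begin

lemma orientations_closed:
  "\<lbrakk>x \<in> carrier S; y \<in> orientations S x\<rbrakk> \<Longrightarrow> y \<in> carrier S"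
  by (auto simp: orientations_def flip_closed)

lemma orientations_eq:
  "\<lbrakk>x \<in> carrier S; y \<in> orientations S x\<rbrakk> \<Longrightarrow> orientations S y = orientations S x"
  by (auto simp: orientations_def flip_flip)

lemma nested_seps_orientation_left:
  "\<lbrakk>r \<in> carrier S; r' \<in> orientations S r\<rbrakk> \<Longrightarrow> nested_seps S r' s = nested_seps S r s"
  by (simp add: nested_seps_def orientations_eq)

lemma nested_seps_sym:
  assumes "r \<in> carrier S" "s \<in> carrier S" "nested_seps S r s"
  shows "nested_seps S s r"
proof -
  obtain r' s' where rs: "r' \<in> orientations S r" "s' \<in> orientations S s" "r' \<sqsubseteq> s'"
    using assms by (auto simp: nested_seps_def)
  then have "flip S s' \<sqsubseteq> flip S r'"
    using assms by (auto intro: flip_antimono orientations_closed)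
  moreover have "flip S s' \<in> orientations S s" "flip S r' \<in> orientations S r"
    using rs assms by (auto simp: orientations_def flip_flip)
  ultimately show ?thesis by (auto simp: nested_seps_def)
qed

lemma nested_seps_refl: "r \<in> carrier S \<Longrightarrow> nested_seps S r r"
  by (auto simp: nested_seps_def orientations_def)

text \<open>Reversing an inequality flips both of its sides, so \<open>r\<close> can keep its given
  orientation: an inequality involving \<open>flip S r\<close> becomes one about \<open>r\<close>
  and the other orientation of \<open>t\<close>.\<close>

lemma nested_sepsE:
  assumes "t \<in> carrier S" "r \<in> carrier S" "nested_seps S t r"
  obtains t' where "t' \<in> orientations S t" "t' \<sqsubseteq> r"
    | t' where "t' \<in> orientations S t" "r \<sqsubseteq> t'"
proof -
  obtain t' r' where tr: "t' \<in> orientations S t" "r' \<in> orientations S r" "t' \<sqsubseteq> r'"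
    using assms by (auto simp: nested_seps_def)
  show thesis
  proof (cases "r' = r")
    case True
    then show thesis using tr that by blast
  next
    case False
    then have "r' = flip S r" using tr by (auto simp: orientations_def)
    then have "r \<sqsubseteq> flip S t'"
      using flip_antimono[of t' r'] tr assms orientations_closed by (auto simp: flip_flip)
    moreover have "flip S t' \<in> orientations S t"
      using tr assms by (auto simp: orientations_def flip_flip)
    ultimately show thesis using that by blast
  qed
qed

end

section \<open>Corner separations and the fish lemma\<close>

context plain_universe
begin

lemma corner_closed:
  "\<lbrakk>r \<in> carrier S; s \<in> carrier S; c \<in> corners S r s\<rbrakk> \<Longrightarrow> c \<in> carrier S"
  by (auto simp: corners_def intro: join_closed orientations_closed)

text \<open>Write the corner as \<open>r' \<squnion> s'\<close>. An orientation of \<open>t\<close>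
  below \<open>r'\<close> or \<open>s'\<close> is below the join. Otherwise \<open>r'\<close> and
  \<open>s'\<close> both lie below orientations of \<open>t\<close>: if these agree, the join lies
  below their common value; if they are opposite, \<open>r'\<close> lies below
  \<open>flip S s'\<close>, so \<open>r\<close> and \<open>s\<close> would not cross.\<close>

lemma fish:
  assumes r: "r \<in> carrier S" and s: "s \<in> carrier S" and t: "t \<in> carrier S"
    and cross: "\<not> nested_seps S r s"
    and tr: "nested_seps S t r" and ts: "nested_seps S t s"
    and c: "c \<in> corners S r s"
  shows "nested_seps S t c"
proof -
  obtain r' s' where rs: "r' \<in> orientations S r" "s' \<in> orientations S s" and c_eq: "c = r' \<squnion> s'"
    using c by (auto simp: corners_def)
  have r': "r' \<in> carrier S" and s': "s' \<in> carrier S"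
    using rs r s orientations_closed by auto
  have tr': "nested_seps S t r'"
    using nested_seps_orientation_left[OF r rs(1)] nested_seps_sym r r' t tr by blast
  have ts': "nested_seps S t s'"
    using nested_seps_orientation_left[OF s rs(2)] nested_seps_sym s s' t ts by blast
  have below: "nested_seps S t c" if "t' \<in> orientations S t" "t' \<sqsubseteq> c" for t'
    using that by (auto simp: nested_seps_def orientations_def)
  have above: "nested_seps S t c" if "t' \<in> orientations S t" "c \<sqsubseteq> t'" for t'
  proof -
    have "nested_seps S c t" using that by (auto simp: nested_seps_def orientations_def)
    then show ?thesis
      using nested_seps_sym corner_closed[OF r s c] t by blast
  qed
  show ?thesis
    using t r' tr'
  proof (cases rule: nested_sepsE)
    case (1 u)
    have "u \<sqsubseteq> c"
      unfolding c_eq by (rule le_trans[OF 1(2) join_left[OF r' s']])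
        (use 1 t r' s' orientations_closed in auto)
    then show ?thesis using below 1 by blast
  next
    case u: (2 u)
    have uc: "u \<in> carrier S" using u t orientations_closed by blast
    show ?thesis
      using t s' ts'
    proof (cases rule: nested_sepsE)
      case (1 v)
      have "v \<sqsubseteq> c"
        unfolding c_eq by (rule le_trans[OF 1(2) join_right[OF r' s']])
          (use 1 t r' s' orientations_closed in auto)
      then show ?thesis using below 1 by blast
    next
      case v: (2 v)
      show ?thesis
      proof (cases "u = v")
        case True
        then have "c \<sqsubseteq> u" unfolding c_eq using u v r' s' uc by (intro join_le) auto
        then show ?thesis using above u by blast
      next
        case False
        then have "v = flip S u"
          using u v t by (auto simp: orientations_def flip_flip)
        then have "u \<sqsubseteq> flip S s'"
          using flip_antimono[of s' v] v s' uc by (simp add: flip_flip flip_closed)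
        then have "r' \<sqsubseteq> flip S s'"
          using le_trans[OF u(2)] r' s' uc flip_closed by blast
        moreover have "flip S s' \<in> orientations S s"
          using rs s by (auto simp: orientations_def flip_flip)
        ultimately show ?thesis
          using cross rs by (auto simp: nested_seps_def)
      qed
    qed
  qed
qed

lemma nested_seps_corner:
  assumes r: "r \<in> carrier S" and s: "s \<in> carrier S" and c: "c \<in> corners S r s"
    and c': "c' \<in> orientations S c"
  shows "nested_seps S r c'" "nested_seps S s c'"
proof -
  obtain r' s' where rs: "r' \<in> orientations S r" "s' \<in> orientations S s" and c_eq: "c = r' \<squnion> s'"
    using c by (auto simp: corners_def)
  have "r' \<in> carrier S" "s' \<in> carrier S"
    using rs r s orientations_closed by auto
  then have "r' \<sqsubseteq> c" "s' \<sqsubseteq> c"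
    by (auto simp: c_eq join_left join_right)
  moreover have "c \<in> orientations S c'"
    using c' corner_closed[OF r s c] by (auto simp: orientations_def flip_flip)
  ultimately show "nested_seps S r c'" "nested_seps S s c'"
    using rs unfolding nested_seps_def by blast+
qed

text \<open>If \<open>r'\<close> is below \<open>s'\<close>, then their join is \<open>s'\<close>
  itself. Hence a nested pair always meets the splintering condition, and only crossing pairs need
  to be examined.\<close>

lemma nested_imp_corner:
  assumes r: "r \<in> carrier S" and s: "s \<in> carrier S" and n: "nested_seps S r s"
  shows "\<exists>c\<in>corners S r s. s \<in> orientations S c"
proof -
  obtain r' s' where rs: "r' \<in> orientations S r" "s' \<in> orientations S s" "r' \<sqsubseteq> s'"
    using n by (auto simp: nested_seps_def)
  have r': "r' \<in> carrier S" and s': "s' \<in> carrier S"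
    using rs r s orientations_closed by auto
  have "r' \<squnion> s' = s'"
    by (intro le_antisym join_le join_right join_closed) (use rs r' s' in auto)
  then have "s' \<in> corners S r s"
    unfolding corners_def using rs by (metis (mono_tags, lifting) mem_Collect_eq)
  moreover have "s \<in> orientations S s'"
    using rs s by (auto simp: orientations_def flip_flip)
  ultimately show ?thesis by blast
qed

section \<open>Nested transversals of finite splintering families\<close>

text \<open>A pair violating the condition in the restricted family must cross, and neither element
  lies in the other unrestricted member. So the original family supplies a corner, which is nested
  with \<open>t\<close> by the fish lemma and therefore survives the restriction.\<close>

lemma splinters_restrict_nested:
  assumes sub: "\<And>B. B \<in> \<B> \<Longrightarrow> B \<subseteq> carrier S" and t: "t \<in> carrier S" and spl: "splinters S \<B>"
  shows "splinters S ((\<lambda>B. {b \<in> B. nested_seps S t b}) ` \<B>)"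
  unfolding splinters_def
proof (intro ballI, rule ccontr)
  fix D D' r s
  assume D: "D \<in> (\<lambda>B. {b \<in> B. nested_seps S t b}) ` \<B>"
      "D' \<in> (\<lambda>B. {b \<in> B. nested_seps S t b}) ` \<B>"
    and rs: "r \<in> D" "s \<in> D'"
    and no: "\<not> (r \<in> D' \<or> s \<in> D \<or> (\<exists>c\<in>corners S r s. orientations S c \<inter> (D \<union> D') \<noteq> {}))"
  obtain B B' where B: "B \<in> \<B>" "B' \<in> \<B>"
    and D_eq: "D = {b \<in> B. nested_seps S t b}" "D' = {b \<in> B'. nested_seps S t b}"
    using D by blast
  have r: "r \<in> B" "nested_seps S t r" and s: "s \<in> B'" "nested_seps S t s"
    using rs D_eq by auto
  have rc: "r \<in> carrier S" and sc: "s \<in> carrier S" using B r s sub by auto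
  have cross: "\<not> nested_seps S r s"
    using nested_imp_corner[OF rc sc] rs(2) no by blast
  have "r \<notin> B'" "s \<notin> B" using r s no D_eq by auto
  then obtain c c' where c: "c \<in> corners S r s" "c' \<in> orientations S c" "c' \<in> B \<union> B'"
    by (rule splintersE[OF spl B r(1) s(1)])
  have cc: "c \<in> carrier S" using corner_closed[OF rc sc c(1)] .
  have "nested_seps S c t"
    using nested_seps_sym[OF t cc] fish[OF rc sc t cross r(2) s(2) c(1)] by blast
  then have "nested_seps S t c'"
    using nested_seps_orientation_left[OF cc c(2)] nested_seps_sym[OF _ t]
      orientations_closed[OF cc c(2)] by blast
  then show False using no c D_eq by blast
qed

text \<open>The members are indexed because restricting them can make distinct members equal;
  \<open>A\<close> is generalized in the induction because the hypothesis is applied to restricted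
  members.\<close>

lemma splinters_finite_nested_transversal:
  assumes "finite I" and "\<And>i. i \<in> I \<Longrightarrow> A i \<noteq> {}" and "\<And>i. i \<in> I \<Longrightarrow> A i \<subseteq> carrier S"
    and "splinters S (A ` I)"
  shows "\<exists>x. (\<forall>i\<in>I. x i \<in> A i) \<and> (\<forall>i\<in>I. \<forall>j\<in>I. nested_seps S (x i) (x j))"
  using assms
proof (induction I arbitrary: A rule: finite_psubset_induct)
  case (psubset I)
  note ne = psubset.prems(1) and sub = psubset.prems(2) and spl = psubset.prems(3)
  \<comment> \<open>If no pair \<open>i\<close>, \<open>a\<close> is as in \<open>common\<close>,
    every element of a member crosses all of some other member; \<open>n\<close> is then any
    index.\<close>
  consider (empty) "I = {}"
    | (common) i a where "i \<in> I" "a \<in> A i" "\<And>j. j \<in> I - {i} \<Longrightarrow> \<exists>b\<in>A j. nested_seps S a b"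
    | (crossing) n where "n \<in> I"
        "\<And>i a. \<lbrakk>i \<in> I; a \<in> A i\<rbrakk> \<Longrightarrow> \<exists>j\<in>I - {i}. \<forall>b\<in>A j. \<not> nested_seps S a b"
    by blast
  then show ?case
  proof cases
    case empty
    then show ?thesis by simp
  next
    case common
    define A' where "A' = (\<lambda>j. {b \<in> A j. nested_seps S a b})"
    have a: "a \<in> carrier S" using common sub by blast
    have "splinters S (A ` (I - {i}))"
      using spl by (auto simp: splinters_def)
    then have "splinters S ((\<lambda>B. {b \<in> B. nested_seps S a b}) ` A ` (I - {i}))"
      by (intro splinters_restrict_nested a) (use sub in auto)
    then have "splinters S (A' ` (I - {i}))"
      by (simp add: A'_def image_image)
    moreover have "A' j \<noteq> {}" "A' j \<subseteq> carrier S" if "j \<in> I - {i}" for j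
      using common(3)[OF that] sub that by (auto simp: A'_def)
    ultimately obtain x where x: "\<And>j. j \<in> I - {i} \<Longrightarrow> x j \<in> A' j"
        "\<And>j k. \<lbrakk>j \<in> I - {i}; k \<in> I - {i}\<rbrakk> \<Longrightarrow> nested_seps S (x j) (x k)"
      using psubset.IH[of "I - {i}" A'] common(1) by blast
    have ax: "x j \<in> A j \<and> nested_seps S a (x j) \<and> nested_seps S (x j) a" if "j \<in> I - {i}" for j
      using x(1)[OF that] sub that nested_seps_sym[OF a] by (auto simp: A'_def)
    show ?thesis
      by (rule exI[of _ "x(i := a)"]) (use ax x(2) common nested_seps_refl[OF a] in auto)
  next
    case crossing
    have "splinters S (A ` (I - {n}))"
      using spl by (auto simp: splinters_def)
    then obtain x where x: "\<And>j. j \<in> I - {n} \<Longrightarrow> x j \<in> A j"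
        "\<And>j k. \<lbrakk>j \<in> I - {n}; k \<in> I - {n}\<rbrakk> \<Longrightarrow> nested_seps S (x j) (x k)"
      using psubset.IH[of "I - {n}" A] crossing(1) ne sub by blast
    obtain a where a: "a \<in> A n" using ne crossing(1) by blast
    obtain j where j: "j \<in> I - {n}" "\<And>b. b \<in> A j \<Longrightarrow> \<not> nested_seps S a b"
      using crossing(2)[OF crossing(1) a] by blast
    obtain k where k: "k \<in> I - {j}" "\<And>b. b \<in> A k \<Longrightarrow> \<not> nested_seps S (x j) b"
      using crossing(2)[of j "x j"] j x by blast
    \<comment> \<open>For any other index \<open>k\<close>, \<open>x k\<close> is an element of
      \<open>A k\<close> nested with \<open>x j\<close>.\<close>
    have "k = n" using k x j by blast
    have ac: "a \<in> carrier S" and xc: "x j \<in> carrier S"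
      using a crossing(1) sub x j by auto
    have "a \<notin> A j" "x j \<notin> A n"
      using j(2) k(2) \<open>k = n\<close> nested_seps_refl ac xc by auto
    then obtain c c' where c: "c \<in> corners S a (x j)" "c' \<in> orientations S c" "c' \<in> A n \<union> A j"
      using splintersE[OF spl, of "A n" "A j" a "x j"] crossing(1) a j(1) x(1)[OF j(1)] by blast
    \<comment> \<open>The corner is nested with both \<open>a\<close> and \<open>x j\<close>, so it
      can lie neither in \<open>A j\<close>, which \<open>a\<close> crosses entirely, nor in
      \<open>A n\<close>, which \<open>x j\<close> crosses entirely.\<close>
    then show ?thesis
      using nested_seps_corner[OF ac xc c(1,2)] j(2) k(2) \<open>k = n\<close> by blast
  qed
qed

end

section \<open>Compactness of the inverse limit\<close>

context finite_universe_inverse_system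
begin

abbreviation (input) X where "X \<equiv> limit_topology P U f"

lemma carrier_limit_subset:
  "carrier L \<subseteq> topspace (product_topology (\<lambda>p. discrete_topology (carrier (U p))) (carrier P))"
  using carrier_limitD(1) by auto

lemma topspace_limit: "topspace X = carrier L"
  using carrier_limit_subset by (auto simp: limit_topology_def)

text \<open>The product of finite discrete spaces is compact, and the limit is closed in it:
  incompatibility with one bonding map depends on two coordinates only and is thus an open
  condition.\<close>

lemma compact_space_limit: "compact_space X"
proof -
  let ?Y = "product_topology (\<lambda>p. discrete_topology (carrier (U p))) (carrier P)"
  have "compact_space ?Y"
    by (simp add: compact_space_product_topology compact_space_discrete_topology finite)
  moreover have "closedin ?Y (carrier L)"
  proof -
    have "openin ?Y {s \<in> topspace ?Y. f q p (s q) \<noteq> s p}"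
      if "p \<in> carrier P" "q \<in> carrier P" for p q
    proof -
      have "openin ?Y {s \<in> topspace ?Y. s p \<in> {a}}" "openin ?Y {s \<in> topspace ?Y. s q \<in> {b}}"
        if "a \<in> carrier (U p)" "b \<in> carrier (U q)" for a b
        by (rule openin_continuous_map_preimage[OF continuous_map_product_projection];
            use that \<open>p \<in> carrier P\<close> \<open>q \<in> carrier P\<close> in simp)+
      then have "openin ?Y ({s \<in> topspace ?Y. s p \<in> {a}} \<inter> {s \<in> topspace ?Y. s q \<in> {b}})"
        if "a \<in> carrier (U p)" "b \<in> carrier (U q)" for a b
        using that by blast
      then have "openin ?Y (\<Union>(a, b)\<in>{(a, b) \<in> carrier (U p) \<times> carrier (U q). f q p b \<noteq> a}.
          {s \<in> topspace ?Y. s p \<in> {a}} \<inter> {s \<in> topspace ?Y. s q \<in> {b}})"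
        by (intro openin_Union) auto
      also have "(\<Union>(a, b)\<in>{(a, b) \<in> carrier (U p) \<times> carrier (U q). f q p b \<noteq> a}.
          {s \<in> topspace ?Y. s p \<in> {a}} \<inter> {s \<in> topspace ?Y. s q \<in> {b}}) =
          {s \<in> topspace ?Y. f q p (s q) \<noteq> s p}"
        using that by (auto simp: PiE_iff)
      finally show ?thesis .
    qed
    then have "openin ?Y (\<Union>(p, q)\<in>{(p, q) \<in> carrier P \<times> carrier P. p \<sqsubset> q}.
        {s \<in> topspace ?Y. f q p (s q) \<noteq> s p})"
      by (intro openin_Union) auto
    also have "(\<Union>(p, q)\<in>{(p, q) \<in> carrier P \<times> carrier P. p \<sqsubset> q}.
        {s \<in> topspace ?Y. f q p (s q) \<noteq> s p}) = topspace ?Y - carrier L"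
      by (auto simp: inverse_limit_def)
    finally show ?thesis using carrier_limit_subset by (simp add: closedin_def)
  qed
  ultimately show ?thesis
    unfolding limit_topology_def
    using closedin_compact_space compact_space_subtopology by blast
qed

lemma openin_coordinate:
  assumes p: "p \<in> carrier P"
  shows "openin X {s \<in> carrier L. s p = a}"
proof -
  have *: "continuous_map X (discrete_topology (carrier (U p))) (\<lambda>s. s p)"
    unfolding limit_topology_def
    by (intro continuous_map_from_subtopology continuous_map_product_projection p)
  \<comment> \<open>Intersecting with the carrier gives an open set of the discrete space even when
    \<open>a\<close> lies outside it.\<close>
  have "openin X {s \<in> topspace X. s p \<in> {a} \<inter> carrier (U p)}"
    by (rule openin_continuous_map_preimage[OF *]) simp
  moreover have "{s \<in> topspace X. s p \<in> {a} \<inter> carrier (U p)} = {s \<in> carrier L. s p = a}"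
    using carrier_limitD(2) p by (auto simp: topspace_limit)
  ultimately show ?thesis by simp
qed

section \<open>Nestedness as a closed relation\<close>

text \<open>A violation of \<open>Q\<close> occurs at a single coordinate, so the complement is a
  union of open rectangles that fix the values there.\<close>

lemma closedin_coordinatewise_relation:
  "closedin (prod_topology X X)
    {(r, s) \<in> carrier L \<times> carrier L. \<forall>p\<in>carrier P. Q p (r p) (s p)}"
proof -
  have "openin (prod_topology X X)
      (\<Union>(p, a, b)\<in>{(p, a, b). p \<in> carrier P \<and> \<not> Q p a b}.
        {r \<in> carrier L. r p = a} \<times> {s \<in> carrier L. s p = b})"
    by (intro openin_Union) (auto simp: openin_prod_Times_iff openin_coordinate)
  also have "(\<Union>(p, a, b)\<in>{(p, a, b). p \<in> carrier P \<and> \<not> Q p a b}.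
        {r \<in> carrier L. r p = a} \<times> {s \<in> carrier L. s p = b}) =
      topspace (prod_topology X X) -
      {(r, s) \<in> carrier L \<times> carrier L. \<forall>p\<in>carrier P. Q p (r p) (s p)}"
    by (auto simp: topspace_limit)
  finally show ?thesis by (auto simp: closedin_def topspace_limit)
qed

lemma closedin_nested_seps:
  "closedin (prod_topology X X) {(r, s) \<in> carrier L \<times> carrier L. nested_seps L r s}"
proof -
  let ?C = "\<lambda>Q. {(r, s) \<in> carrier L \<times> carrier L. \<forall>p\<in>carrier P. Q p (r p) (s p)}"
  \<comment> \<open>One closed relation for each of the four choices of orientations of
    \<open>r\<close> and \<open>s\<close>.\<close>
  have "{(r, s) \<in> carrier L \<times> carrier L. nested_seps L r s} =
      ?C (\<lambda>p a b. a \<sqsubseteq>\<^bsub>U p\<^esub> b) \<union> ?C (\<lambda>p a b. a \<sqsubseteq>\<^bsub>U p\<^esub> flip (U p) b) \<union>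
      (?C (\<lambda>p a b. flip (U p) a \<sqsubseteq>\<^bsub>U p\<^esub> b) \<union> ?C (\<lambda>p a b. flip (U p) a \<sqsubseteq>\<^bsub>U p\<^esub> flip (U p) b))"
    by (auto simp: nested_seps_def orientations_def le_limit flip_limit)
  then show ?thesis
    by (simp only:) (intro closedin_Un closedin_coordinatewise_relation)
qed

text \<open>The closure of a square is the square of the closure, and it stays inside the closed
  nestedness relation.\<close>

lemma closure_of_nested_set:
  assumes "N \<subseteq> carrier L" "nested_set L N"
  shows "nested_set L (X closure_of N)"
proof -
  have "prod_topology X X closure_of (N \<times> N) \<subseteq>
      {(r, s) \<in> carrier L \<times> carrier L. nested_seps L r s}"
    by (rule closure_of_minimal[OF _ closedin_nested_seps])
      (use assms in \<open>auto simp: nested_set_def\<close>)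
  then show ?thesis by (auto simp: closure_of_Times nested_set_def)
qed

section \<open>From finite to arbitrary splintering families\<close>

lemma splinters_nested_transversal:
  assumes ne: "\<And>B. B \<in> \<B> \<Longrightarrow> B \<noteq> {}" and cl: "\<And>B. B \<in> \<B> \<Longrightarrow> closedin X B"
    and spl: "splinters L \<B>"
  shows "\<exists>x. (\<forall>B\<in>\<B>. x B \<in> B) \<and> (\<forall>B\<in>\<B>. \<forall>B'\<in>\<B>. nested_seps L (x B) (x B'))"
\<comment> \<open>With \<B> nonempty there is at least one constraint set, so a point of the
  intersection taken at the end lies in \<open>topspace Y\<close>.\<close>
proof (cases "\<B> = {}")
  case False
  interpret lim: plain_universe L
    by (intro plain_universe.intro plain_separation_system.intro separation_system_limit
        universe_limit)
  have sub: "B \<subseteq> carrier L" if "B \<in> \<B>" for B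
    using closedin_subset[OF cl[OF that]] by (simp add: topspace_limit)
  \<comment> \<open>The points of \<open>Y\<close> are the choice functions on \<B>. Each
    \<open>C (B, B')\<close> is the closed constraint that the two choices be nested, so the finite
    intersection property applies.\<close>
  define Y where "Y = product_topology (\<lambda>B. subtopology X B) \<B>"
  have topY: "topspace Y = (\<Pi>\<^sub>E B\<in>\<B>. B)"
    using sub by (auto simp: Y_def topspace_limit PiE_iff)
  have "compact_space Y"
    unfolding Y_def using cl compact_space_limit
    by (auto simp: compact_space_product_topology intro!: compact_space_subtopology
        closedin_compact_space)
  define C where "C = (\<lambda>(B, B'). {x \<in> topspace Y. nested_seps L (x B) (x B')})"
  have "closedin Y (C (B, B'))" if B: "B \<in> \<B>" "B' \<in> \<B>" for B B'
  proof -
    have proj: "continuous_map Y X (\<lambda>x. x B)" if "B \<in> \<B>" for B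
      using continuous_map_product_projection[OF that, of "\<lambda>B. subtopology X B"]
      by (simp add: Y_def continuous_map_in_subtopology)
    have "continuous_map Y (prod_topology X X) (\<lambda>x. (x B, x B'))"
      using proj[OF B(1)] proj[OF B(2)] by (simp add: continuous_map_pairedI)
    from closedin_continuous_map_preimage[OF this closedin_nested_seps]
    show ?thesis
      by (rule back_subst[where P = "closedin Y"])
        (use B sub in \<open>auto simp: C_def topY PiE_iff\<close>)
  qed
  then have closed: "\<forall>D\<in>C ` (\<B> \<times> \<B>). closedin Y D" by auto
  have "\<Inter>F \<noteq> {}" if F: "finite F" "F \<subseteq> C ` (\<B> \<times> \<B>)" for F
  proof -
    obtain K where K: "finite K" "K \<subseteq> \<B> \<times> \<B>" "F = C ` K"
      using finite_subset_image[OF F] by blast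
    \<comment> \<open>Finitely many constraints involve only the members in \<open>I\<close>, where
      the finite case applies with each member as its own index.\<close>
    define I where "I = fst ` K \<union> snd ` K"
    have I: "finite I" "I \<subseteq> \<B>" using K by (auto simp: I_def)
    have "splinters L ((\<lambda>B. B) ` I)"
      using spl I(2) by (auto simp: splinters_def subset_iff)
    then have "\<exists>x. (\<forall>B\<in>I. x B \<in> B) \<and> (\<forall>B\<in>I. \<forall>B'\<in>I. nested_seps L (x B) (x B'))"
      by (intro lim.splinters_finite_nested_transversal[where A = "\<lambda>B. B"] I(1) ne sub
          subsetD[OF I(2)])
    then obtain x where x: "\<And>B. B \<in> I \<Longrightarrow> x B \<in> B"
        "\<And>B B'. \<lbrakk>B \<in> I; B' \<in> I\<rbrakk> \<Longrightarrow> nested_seps L (x B) (x B')"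
      by blast
    \<comment> \<open>Outside \<open>I\<close> any element will do, since the constraints from
      \<open>K\<close> do not mention those members.\<close>
    define y where "y = (\<lambda>B\<in>\<B>. if B \<in> I then x B else SOME b. b \<in> B)"
    have "y \<in> topspace Y"
      unfolding topY
    proof (rule PiE_I)
      fix B assume B: "B \<in> \<B>"
      show "y B \<in> B"
        using B x(1) some_in_eq[of B] ne[OF B] by (simp add: y_def)
    qed (simp add: y_def)
    moreover have "nested_seps L (y B) (y B')" if "(B, B') \<in> K" for B B'
    proof -
      have "B \<in> I" "B' \<in> I" using that by (auto simp: I_def intro: rev_image_eqI)
      then show ?thesis using x(2) I(2) by (auto simp: y_def subset_iff)
    qed
    ultimately have "y \<in> \<Inter>F" by (auto simp: K C_def)
    then show ?thesis by blast
  qed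
  then have "\<Inter>(C ` (\<B> \<times> \<B>)) \<noteq> {}"
    using \<open>compact_space Y\<close>[unfolded compact_space_fip, rule_format, of "C ` (\<B> \<times> \<B>)"] closed
    by (simp del: INT_simps)
  then obtain x where x: "x \<in> \<Inter>(C ` (\<B> \<times> \<B>))" by blast
  have "x \<in> topspace Y" "\<forall>B\<in>\<B>. \<forall>B'\<in>\<B>. nested_seps L (x B) (x B')"
    using x False by (auto simp: C_def)
  then show ?thesis by (auto simp: topY PiE_iff)
qed simp

end

theorem theorem3p5:
  fixes P :: "'p gorder" and U :: "'p \<Rightarrow> 'a sep_system"
    and f :: "'p \<Rightarrow> 'p \<Rightarrow> 'a \<Rightarrow> 'a" and \<B> :: "('p \<Rightarrow> 'a) set set"
  assumes "finite_universe_inverse_system P U f"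
    and "\<And>B. B \<in> \<B> \<Longrightarrow> B \<noteq> {}"
    and "\<And>B. B \<in> \<B> \<Longrightarrow> closedin (limit_topology P U f) B"
    and "splinters (inverse_limit P U f) \<B>"
  shows "\<exists>N. N \<subseteq> carrier (inverse_limit P U f) \<and>
             closedin (limit_topology P U f) N \<and>
             nested_set (inverse_limit P U f) N \<and>
             (\<forall>B\<in>\<B>. N \<inter> B \<noteq> {})"
proof -
  interpret finite_universe_inverse_system P U f by (rule assms(1))
  obtain x where x: "\<And>B. B \<in> \<B> \<Longrightarrow> x B \<in> B"
      "\<And>B B'. \<lbrakk>B \<in> \<B>; B' \<in> \<B>\<rbrakk> \<Longrightarrow> nested_seps L (x B) (x B')"
    using splinters_nested_transversal[OF assms(2-4)] by blast
  have xL: "x ` \<B> \<subseteq> carrier L"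
    using x(1) closedin_subset[OF assms(3)] by (auto simp: topspace_limit)
  have "x ` \<B> \<subseteq> X closure_of (x ` \<B>)"
    using xL by (intro closure_of_subset) (simp add: topspace_limit)
  moreover have "nested_set L (X closure_of (x ` \<B>))"
    using x(2) by (intro closure_of_nested_set xL) (auto simp: nested_set_def)
  moreover have "X closure_of (x ` \<B>) \<subseteq> carrier L"
    using closure_of_subset_topspace[of X] by (simp add: topspace_limit)
  ultimately show ?thesis
    using x(1) by (intro exI[of _ "X closure_of (x ` \<B>)"]) auto
qed

end
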